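(* Let $N\ge 1$ and let $f$ be a slice polyanalytic function of order $N$ on an axially symmetric slice domain $\Omega\subset\mathbb{H}$. Then there exist slice regular functions $f_0,\dots,f_{N-1}$ on $\Omega$ such that $$f(q)=\sum_{k=0}^{N-1}\overline{q}^{\,k}f_k(q)\qquad\text{for all } q\in\Omega.$$
   Context: $\mathbb{H}$ denotes the quaternions, $\mathbb{S}=\{q\in\mathbb{H}: q^2=-1\}$, and for $I\in\mathbb{S}$, $\mathbb{C}_I=\mathbb{R}+\mathbb{R}I$. For $\Omega\subset\mathbb{H}$ put $\Omega_I=\Omega\cap\mathbb{C}_I$. An open set $\Omega$ is axially symmetric if $x+Iy\in\Omega$ implies $x+Jy\in\Omega$ for all $J\in\mathbb{S}$. A domain (nonempty connected open set) $\Omega\subset\mathbb{H}$ is a slice domain if $\Omega\cap\mathbb{R}\neq\emptyset$ and $\Omega_I$ is a domain of $\mathbb{C}_I$ for every $I\in\mathbb{S}$. Slice polyanalytic functions: let $\Omega$ be an axially symmetric open set and $\mathcal{U}=\{(x,y)\in\mathbb{R}^2: x+Iy\in\Omega \text{ for all } I\in\mathbb{S}\}$. A function $f:\Omega\to\mathbb{H}$ is a (left) slice function if $f(x+Iy)=\alpha(x,y)+I\beta(x,y)$ for all $x+Iy\in\Omega$, $I\in\mathbb{S}$, where $\alpha,\beta:\mathcal{U}\to\mathbb{H}$ do not depend on $I$ and satisfy $\alpha(x,-y)=\alpha(x,y)$, $\beta(x,-y)=-\beta(x,y)$. If moreover $\alpha,\beta$ are of class $\mathcal{C}^N$ and $\frac{1}{2^N}(\partial_x+I\partial_y)^N(\alpha(x,y)+I\beta(x,y))=0$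 for all $I\in\mathbb{S}$, then $f$ is called (left) slice polyanalytic of order $N$. A slice regular function is a slice polyanalytic function of order $1$. *)

theory Defs
  imports "HOL-Analysis.Analysis"
begin

section \<open>Quaternions\<close>

codatatype quat = Quat (qRe: real) (qIm1: real) (qIm2: real) (qIm3: real)

lemma quat_eqI [intro?]:
  "\<lbrakk>qRe x = qRe y; qIm1 x = qIm1 y; qIm2 x = qIm2 y; qIm3 x = qIm3 y\<rbrakk> \<Longrightarrow> x = y"
  by (rule quat.expand) simp

lemma quat_eq_iff:
  "x = y \<longleftrightarrow> qRe x = qRe y \<and> qIm1 x = qIm1 y \<and> qIm2 x = qIm2 y \<and> qIm3 x = qIm3 y"
  by (auto intro: quat_eqI)

instantiation quat :: ab_group_add
begin

primcorec zero_quat where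
  "qRe 0 = 0" | "qIm1 0 = 0" | "qIm2 0 = 0" | "qIm3 0 = 0"

primcorec plus_quat where
  "qRe (x + y) = qRe x + qRe y"
| "qIm1 (x + y) = qIm1 x + qIm1 y"
| "qIm2 (x + y) = qIm2 x + qIm2 y"
| "qIm3 (x + y) = qIm3 x + qIm3 y"

primcorec uminus_quat where
  "qRe (- x) = - qRe x"
| "qIm1 (- x) = - qIm1 x"
| "qIm2 (- x) = - qIm2 x"
| "qIm3 (- x) = - qIm3 x"

primcorec minus_quat where
  "qRe (x - y) = qRe x - qRe y"
| "qIm1 (x - y) = qIm1 x - qIm1 y"
| "qIm2 (x - y) = qIm2 x - qIm2 y"
| "qIm3 (x - y) = qIm3 x - qIm3 y"

instance
  by standard (simp_all add: quat_eq_iff)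

end

instantiation quat :: ring_1
begin

primcorec one_quat where
  "qRe 1 = 1" | "qIm1 1 = 0" | "qIm2 1 = 0" | "qIm3 1 = 0"

primcorec times_quat where
  "qRe (x * y) = qRe x * qRe y - qIm1 x * qIm1 y - qIm2 x * qIm2 y - qIm3 x * qIm3 y"
| "qIm1 (x * y) = qRe x * qIm1 y + qIm1 x * qRe y + qIm2 x * qIm3 y - qIm3 x * qIm2 y"
| "qIm2 (x * y) = qRe x * qIm2 y - qIm1 x * qIm3 y + qIm2 x * qRe y + qIm3 x * qIm1 y"
| "qIm3 (x * y) = qRe x * qIm3 y + qIm1 x * qIm2 y - qIm2 x * qIm1 y + qIm3 x * qRe y"

instance
  by standard (simp_all add: quat_eq_iff algebra_simps)

end

instantiation quat :: real_algebra_1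
begin

primcorec scaleR_quat where
  "qRe (r *\<^sub>R x) = r * qRe x"
| "qIm1 (r *\<^sub>R x) = r * qIm1 x"
| "qIm2 (r *\<^sub>R x) = r * qIm2 x"
| "qIm3 (r *\<^sub>R x) = r * qIm3 x"

instance
  by standard (simp_all add: quat_eq_iff algebra_simps)

end

primcorec qcnj :: "quat \<Rightarrow> quat" where
  "qRe (qcnj q) = qRe q"
| "qIm1 (qcnj q) = - qIm1 q"
| "qIm2 (qcnj q) = - qIm2 q"
| "qIm3 (qcnj q) = - qIm3 q"

instantiation quat :: real_inner
begin

definition inner_quat :: "quat \<Rightarrow> quat \<Rightarrow> real" where
  "inner_quat x y = qRe x * qRe y + qIm1 x * qIm1 y + qIm2 x * qIm2 y + qIm3 x * qIm3 y"

definition norm_quat :: "quat \<Rightarrow> real" where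
  "norm_quat x = sqrt (inner x x)"

definition sgn_quat :: "quat \<Rightarrow> quat" where
  "sgn_quat x = x /\<^sub>R norm x"

definition dist_quat :: "quat \<Rightarrow> quat \<Rightarrow> real" where
  "dist_quat x y = norm (x - y)"

definition uniformity_quat :: "(quat \<times> quat) filter" where
  "uniformity_quat = (INF e\<in>{0 <..}. principal {(x, y). dist x y < e})"

definition open_quat :: "quat set \<Rightarrow> bool" where
  "open_quat S \<longleftrightarrow> (\<forall>x\<in>S. \<forall>\<^sub>F (x', y) in uniformity. x' = x \<longrightarrow> y \<in> S)"

instance
proof
  fix x y z :: quat and r :: real and S :: "quat set"
  show "dist x y = norm (x - y)" by (rule dist_quat_def)
  show "sgn x = x /\<^sub>R norm x" by (rule sgn_quat_def)
  show "(uniformity :: (quat \<times> quat) filter) = (INF e\<in>{0 <..}. principal {(x, y). dist x y < e})"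
    by (rule uniformity_quat_def)
  show "open S \<longleftrightarrow> (\<forall>x\<in>S. \<forall>\<^sub>F (x', y) in uniformity. x' = x \<longrightarrow> y \<in> S)"
    by (rule open_quat_def)
  show "inner x y = inner y x" by (simp add: inner_quat_def mult.commute)
  show "inner (x + y) z = inner x z + inner y z" by (simp add: inner_quat_def algebra_simps)
  show "inner (r *\<^sub>R x) y = r * inner x y" by (simp add: inner_quat_def algebra_simps)
  show "0 \<le> inner x x" by (simp add: inner_quat_def)
  show "inner x x = 0 \<longleftrightarrow> x = 0"
    by (auto simp: inner_quat_def quat_eq_iff add_nonneg_eq_0_iff)
  show "norm x = sqrt (inner x x)" by (rule norm_quat_def)
qed

end

lemma norm_mult_quat: "norm (x * y) = norm x * norm (y :: quat)"
  unfolding norm_quat_def inner_quat_def real_sqrt_mult[symmetric]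
  by (rule arg_cong[where f = sqrt]) (simp add: algebra_simps)

instantiation quat :: real_normed_div_algebra
begin

definition inverse_quat :: "quat \<Rightarrow> quat" where
  "inverse_quat x = qcnj x /\<^sub>R (norm x)\<^sup>2"

definition divide_quat :: "quat \<Rightarrow> quat \<Rightarrow> quat" where
  "divide_quat x y = x * inverse y"

instance
proof
  fix x y :: quat
  have n: "(norm x)\<^sup>2 = (qRe x)\<^sup>2 + (qIm1 x)\<^sup>2 + (qIm2 x)\<^sup>2 + (qIm3 x)\<^sup>2"
    unfolding power2_norm_eq_inner by (simp add: inner_quat_def power2_eq_square)
  have c: "x * qcnj x = (norm x)\<^sup>2 *\<^sub>R 1" "qcnj x * x = (norm x)\<^sup>2 *\<^sub>R 1"
    unfolding n by (simp_all add: quat_eq_iff power2_eq_square)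
  show "inverse x * x = 1" "x * inverse x = 1" if "x \<noteq> 0"
    using that by (simp_all add: inverse_quat_def c)
  show "x div y = x * inverse y" by (rule divide_quat_def)
  show "inverse (0 :: quat) = 0" by (simp add: inverse_quat_def)
  show "norm (x * y) = norm x * norm y" by (rule norm_mult_quat)
qed

end

instantiation quat :: euclidean_space
begin

definition Basis_quat :: "quat set" where
  "Basis_quat = {Quat 1 0 0 0, Quat 0 1 0 0, Quat 0 0 1 0, Quat 0 0 0 1}"

instance
proof
  fix x u v :: quat
  show "(Basis :: quat set) \<noteq> {}" "finite (Basis :: quat set)"
    by (simp_all add: Basis_quat_def)
  show "inner u v = (if u = v then 1 else 0)" if "u \<in> Basis" "v \<in> Basis"
    using that unfolding Basis_quat_def by (elim insertE emptyE; simp add: inner_quat_def)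
  show "(\<forall>u\<in>Basis. inner x u = 0) \<longleftrightarrow> x = 0"
    unfolding Basis_quat_def by (simp add: inner_quat_def) (simp add: quat_eq_iff)
qed

end


section \<open>Slices and slice domains\<close>

definition im_sphere :: "quat set" where
  "im_sphere = {q. q\<^sup>2 = - 1}"

definition slice_plane :: "quat \<Rightarrow> quat set" where
  "slice_plane I = {of_real x + I * of_real y | x y. True}"

definition axially_symmetric :: "quat set \<Rightarrow> bool" where
  "axially_symmetric \<Omega> \<longleftrightarrow>
     (\<forall>x y. \<forall>I\<in>im_sphere. of_real x + I * of_real y \<in> \<Omega> \<longrightarrow>
        (\<forall>J\<in>im_sphere. of_real x + J * of_real y \<in> \<Omega>))"

text \<open>A domain of \<open>slice_plane I\<close> is open in the relative topology of that plane.\<close>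

definition slice_domain :: "quat set \<Rightarrow> bool" where
  "slice_domain \<Omega> \<longleftrightarrow>
     \<Omega> \<noteq> {} \<and> open \<Omega> \<and> connected \<Omega> \<and> \<Omega> \<inter> \<real> \<noteq> {} \<and>
     (\<forall>I\<in>im_sphere.
        \<Omega> \<inter> slice_plane I \<noteq> {} \<and>
        openin (top_of_set (slice_plane I)) (\<Omega> \<inter> slice_plane I) \<and>
        connected (\<Omega> \<inter> slice_plane I))"


section \<open>Partial derivatives on the real plane\<close>

definition partial_x :: "(real \<times> real \<Rightarrow> 'a::real_normed_vector) \<Rightarrow> real \<times> real \<Rightarrow> 'a" where
  "partial_x g = (\<lambda>(x, y). vector_derivative (\<lambda>t. g (t, y)) (at x))"

definition partial_y :: "(real \<times> real \<Rightarrow> 'a::real_normed_vector) \<Rightarrow> real \<times> real \<Rightarrow> 'a" where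
  "partial_y g = (\<lambda>(x, y). vector_derivative (\<lambda>t. g (x, t)) (at y))"

text \<open>
  \<open>Cn_on n U g\<close>, for open \<open>U\<close>: all iterated partial derivatives of \<open>g\<close> of order at
  most \<open>n\<close> exist and are continuous on \<open>U\<close>. The existence clauses are needed because
  \<^const>\<open>vector_derivative\<close> is total.
\<close>

primrec Cn_on :: "nat \<Rightarrow> (real \<times> real) set \<Rightarrow> (real \<times> real \<Rightarrow> 'a::real_normed_vector) \<Rightarrow> bool" where
  "Cn_on 0 U g \<longleftrightarrow> continuous_on U g"
| "Cn_on (Suc n) U g \<longleftrightarrow>
     continuous_on U g \<and>
     (\<forall>(x, y)\<in>U. (\<lambda>t. g (t, y)) differentiable at x \<and> (\<lambda>t. g (x, t)) differentiable at y) \<and>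
     Cn_on n U (partial_x g) \<and> Cn_on n U (partial_y g)"


section \<open>Slice polyanalytic functions\<close>

text \<open>
  Functions on \<open>\<Omega>\<close> and on \<open>slice_base \<Omega>\<close> are total functions of which only the values on
  these sets matter; for open axially symmetric \<open>\<Omega>\<close> the set \<open>slice_base \<Omega>\<close> is open, so
  the derivatives below do not depend on values outside it.
\<close>

definition slice_base :: "quat set \<Rightarrow> (real \<times> real) set" where
  "slice_base \<Omega> = {(x, y). \<forall>I\<in>im_sphere. of_real x + I * of_real y \<in> \<Omega>}"

definition slice_decomposition ::
    "quat set \<Rightarrow> (quat \<Rightarrow> quat) \<Rightarrow> (real \<times> real \<Rightarrow> quat) \<Rightarrow> (real \<times> real \<Rightarrow> quat) \<Rightarrow> bool" where
  "slice_decomposition \<Omega> f \<alpha> \<beta> \<longleftrightarrow>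
     (\<forall>I\<in>im_sphere. \<forall>x y. of_real x + I * of_real y \<in> \<Omega> \<longrightarrow>
        f (of_real x + I * of_real y) = \<alpha> (x, y) + I * \<beta> (x, y)) \<and>
     (\<forall>(x, y)\<in>slice_base \<Omega>. \<alpha> (x, - y) = \<alpha> (x, y) \<and> \<beta> (x, - y) = - \<beta> (x, y))"

definition cauchy_riemann_op :: "quat \<Rightarrow> (real \<times> real \<Rightarrow> quat) \<Rightarrow> real \<times> real \<Rightarrow> quat" where
  "cauchy_riemann_op I g = (\<lambda>p. partial_x g p + I * partial_y g p)"

definition slice_polyanalytic :: "nat \<Rightarrow> quat set \<Rightarrow> (quat \<Rightarrow> quat) \<Rightarrow> bool" where
  "slice_polyanalytic N \<Omega> f \<longleftrightarrow>
     (\<exists>\<alpha> \<beta>. slice_decomposition \<Omega> f \<alpha> \<beta> \<and>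
        Cn_on N (slice_base \<Omega>) \<alpha> \<and> Cn_on N (slice_base \<Omega>) \<beta> \<and>
        (\<forall>I\<in>im_sphere. \<forall>p\<in>slice_base \<Omega>.
           (1 / 2 ^ N) *\<^sub>R (cauchy_riemann_op I ^^ N) (\<lambda>p. \<alpha> p + I * \<beta> p) p = 0))"

definition slice_regular :: "quat set \<Rightarrow> (quat \<Rightarrow> quat) \<Rightarrow> bool" where
  "slice_regular \<Omega> f \<longleftrightarrow> slice_polyanalytic 1 \<Omega> f"

end

theory Submission
  imports Defs
begin

text \<open>
  Write \<open>D\<close> for \<open>\<partial>\<^sub>x + I \<partial>\<^sub>y\<close>, acting on the restriction of a slice function to the plane of \<open>I\<close>.
  The conjugate variable \<open>x - I y\<close> commutes with \<open>I\<close> and satisfies \<open>D (x - I y) = 2\<close>, so left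
  multiplication by it obeys \<open>D (qcnj q * f) = 2 f + qcnj q * D f\<close>
  (\<open>has_slice_dbar_qcnj_mult\<close>). Hence, for a slice regular \<open>g\<close>,
  \<open>D (qcnj q ^ (k + 1) * g) = 2 (k + 1) qcnj q ^ k * g\<close>: every term of the wanted expansion has
  an explicit antiderivative under \<open>D\<close> of the same shape.

  This makes induction on the order work. If \<open>D\<^sup>N\<^sup>+\<^sup>1 f = 0\<close>, then \<open>D f\<close> is annihilated by \<open>D\<^sup>N\<close>, so
  \<open>D f = (\<Sum>k<N. qcnj q ^ k * g\<^sub>k)\<close> with \<open>g\<^sub>k\<close> slice regular. Subtracting from \<open>f\<close> the sum of the
  terms \<open>qcnj q ^ (k + 1) * g\<^sub>k / (2 (k + 1))\<close> leaves a function annihilated by \<open>D\<close>, which is the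
  coefficient of \<open>qcnj q ^ 0\<close>.

  For the induction, \<open>D f\<close> has to be a slice function in its own right, with
  components independent of \<open>I\<close>. If \<open>f\<close> has components \<open>\<alpha>\<close>, \<open>\<beta>\<close>, then
  \<open>D f = (\<alpha>\<^sub>x - \<beta>\<^sub>y) + I (\<beta>\<^sub>x + \<alpha>\<^sub>y)\<close> because \<open>I\<^sup>2 = - 1\<close>. Differentiation in \<open>y\<close> exchanges even and
  odd functions and differentiation in \<open>x\<close> preserves them, so these components again have the required
  parities, and \<open>slice_function_exists\<close> turns them back into a function of a quaternion
  (\<open>slice_dbar_exists\<close>). Everything else is the closure of \<open>C\<^sup>n\<close> slice functions under sums, real
  multiples and multiplication by \<open>qcnj q\<close>.
\<close>

section \<open>Functions of class \<open>C\<^sup>n\<close> in the plane\<close>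

lemma continuous_on_Cn_on: "Cn_on n U g \<Longrightarrow> continuous_on U g"
  by (cases n) auto

lemma vector_derivative_cong_open:
  fixes f g :: "real \<Rightarrow> 'a::real_normed_vector"
  assumes "open S" "x \<in> S" "\<And>t. t \<in> S \<Longrightarrow> f t = g t"
  shows "vector_derivative f (at x) = vector_derivative g (at x)"
  by (rule vector_derivative_cong_eq)
    (use assms in \<open>auto simp: eventually_nhds\<close>)

lemma open_horizontal_line:
  fixes U :: "(real \<times> real) set"
  assumes "open U" shows "open {t. (t, y) \<in> U}"
  using open_vimage[OF assms, of "\<lambda>t. (t, y)"] by (simp add: vimage_def continuous_on_Pair)

lemma open_vertical_line:
  fixes U :: "(real \<times> real) set"
  assumes "open U" shows "open {t. (x, t) \<in> U}"
  using open_vimage[OF assms, of "\<lambda>t. (x, t)"] by (simp add: vimage_def continuous_on_Pair)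

lemma partial_x_cong:
  assumes "open U" "p \<in> U" "\<And>p. p \<in> U \<Longrightarrow> f p = g p"
  shows "partial_x f p = partial_x g p"
  using assms(2,3) unfolding partial_x_def
  by (auto split: prod.splits intro!: vector_derivative_cong_open[OF open_horizontal_line[OF assms(1)]])

lemma partial_y_cong:
  assumes "open U" "p \<in> U" "\<And>p. p \<in> U \<Longrightarrow> f p = g p"
  shows "partial_y f p = partial_y g p"
  using assms(2,3) unfolding partial_y_def
  by (auto split: prod.splits intro!: vector_derivative_cong_open[OF open_vertical_line[OF assms(1)]])

lemma differentiable_cong_open:
  fixes f g :: "real \<Rightarrow> 'a::real_normed_vector"
  assumes "f differentiable at x" "open S" "x \<in> S" "\<And>t. t \<in> S \<Longrightarrow> f t = g t"
  shows "g differentiable at x"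
  using assms unfolding differentiable_def by (metis has_derivative_transform_within_open)

lemma Cn_on_cong:
  assumes "open U" "Cn_on n U f" "\<And>p. p \<in> U \<Longrightarrow> f p = g p"
  shows "Cn_on n U g"
  using assms(2,3)
proof (induction n arbitrary: f g)
  case 0
  then show ?case by (simp cong: continuous_on_cong)
next
  case (Suc n)
  have "Cn_on n U (partial_x g)"
    by (rule Suc.IH[of "partial_x f"])
      (use Suc.prems partial_x_cong[OF assms(1), of _ f g] in auto)
  moreover have "Cn_on n U (partial_y g)"
    by (rule Suc.IH[of "partial_y f"])
      (use Suc.prems partial_y_cong[OF assms(1), of _ f g] in auto)
  moreover have "continuous_on U g"
    using Suc.prems by (simp cong: continuous_on_cong)
  moreover have "(\<lambda>t. g (t, y)) differentiable at x" if "(x, y) \<in> U" for x y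
    by (rule differentiable_cong_open[of "\<lambda>t. f (t, y)", OF _ open_horizontal_line[OF assms(1)]])
      (use Suc.prems that in auto)
  moreover have "(\<lambda>t. g (x, t)) differentiable at y" if "(x, y) \<in> U" for x y
    by (rule differentiable_cong_open[of "\<lambda>t. f (x, t)", OF _ open_vertical_line[OF assms(1)]])
      (use Suc.prems that in auto)
  ultimately show ?case by auto
qed

text \<open>
  A relation carries the existence of both partial derivatives together with their values, which
  the total functions \<^const>\<open>partial_x\<close> and \<^const>\<open>partial_y\<close> do not.
\<close>

definition has_partials ::
    "(real \<times> real \<Rightarrow> 'a::real_normed_vector) \<Rightarrow> 'a \<Rightarrow> 'a \<Rightarrow> real \<times> real \<Rightarrow> bool" where
  "has_partials g a b p \<longleftrightarrow>
     ((\<lambda>t. g (t, snd p)) has_vector_derivative a) (at (fst p)) \<and>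
     ((\<lambda>t. g (fst p, t)) has_vector_derivative b) (at (snd p))"

lemma has_partials_imp:
  assumes "has_partials g a b p"
  shows "partial_x g p = a" "partial_y g p = b"
  using assms unfolding has_partials_def partial_x_def partial_y_def
  by (auto simp: split_beta vector_derivative_at)

lemma Cn_on_has_partials:
  assumes "Cn_on (Suc n) U g" "p \<in> U"
  shows "has_partials g (partial_x g p) (partial_y g p) p"
  using assms unfolding has_partials_def partial_x_def partial_y_def
  by (auto simp: split_beta vector_derivative_works[symmetric])

text \<open>
  This form of the recursion lets the partial derivatives be given by formulas that are valid
  on \<open>U\<close> only.
\<close>

lemma Cn_on_SucI:
  assumes "open U" "continuous_on U g" "\<And>p. p \<in> U \<Longrightarrow> has_partials g (gx p) (gy p) p"
    and "Cn_on n U gx" "Cn_on n U gy"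
  shows "Cn_on (Suc n) U g"
proof -
  have "Cn_on n U (partial_x g)" "Cn_on n U (partial_y g)"
    by (rule Cn_on_cong[OF assms(1)], fact, simp add: has_partials_imp[OF assms(3)])+
  moreover have "(\<lambda>t. g (t, y)) differentiable at x \<and> (\<lambda>t. g (x, t)) differentiable at y"
    if "(x, y) \<in> U" for x y
    using assms(3)[OF that] unfolding has_partials_def
    by (auto intro: differentiableI_vector)
  ultimately show ?thesis using assms(2) by auto
qed

lemma Cn_on_SucD: "Cn_on (Suc n) U g \<Longrightarrow> Cn_on n U g"
proof (induction n arbitrary: g)
  case (Suc n)
  have "Cn_on (Suc n) U (partial_x g)" "Cn_on (Suc n) U (partial_y g)"
    using Suc.prems unfolding Cn_on.simps(2)[of "Suc n" U g] by blast+
  from Suc.IH[OF this(1)] Suc.IH[OF this(2)] Suc.prems show ?case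
    unfolding Cn_on.simps(2)[of _ U g] by blast
qed simp

lemma has_partials_add:
  "has_partials f a b p \<Longrightarrow> has_partials g c d p \<Longrightarrow> has_partials (\<lambda>p. f p + g p) (a + c) (b + d) p"
  unfolding has_partials_def by (auto intro!: derivative_intros)

lemma has_partials_linear:
  assumes "bounded_linear T" "has_partials f a b p"
  shows "has_partials (\<lambda>p. T (f p)) (T a) (T b) p"
  using assms(2) unfolding has_partials_def
  by (auto intro: bounded_linear.has_vector_derivative[OF assms(1)])

lemma has_partials_fst:
  "has_partials f a b p \<Longrightarrow> has_partials (\<lambda>p. fst p *\<^sub>R f p) (f p + fst p *\<^sub>R a) (fst p *\<^sub>R b) p"
  unfolding has_partials_def
  by (auto intro!: derivative_eq_intros simp: has_real_derivative_iff_has_vector_derivative[symmetric])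

lemma has_partials_snd:
  "has_partials f a b p \<Longrightarrow> has_partials (\<lambda>p. snd p *\<^sub>R f p) (snd p *\<^sub>R a) (f p + snd p *\<^sub>R b) p"
  unfolding has_partials_def
  by (auto intro!: derivative_eq_intros simp: has_real_derivative_iff_has_vector_derivative[symmetric])

lemma Cn_on_add:
  assumes "open U" "Cn_on n U f" "Cn_on n U g"
  shows "Cn_on n U (\<lambda>p. f p + g p)"
  using assms(2,3)
proof (induction n arbitrary: f g)
  case (Suc n)
  show ?case
    by (rule Cn_on_SucI[OF assms(1) _ has_partials_add[OF Cn_on_has_partials Cn_on_has_partials]])
      (use Suc in \<open>auto intro: continuous_on_add\<close>)
qed (auto intro: continuous_on_add)

lemma Cn_on_linear:
  assumes "open U" "bounded_linear T" "Cn_on n U f"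
  shows "Cn_on n U (\<lambda>p. T (f p))"
  using assms(3)
proof (induction n arbitrary: f)
  case 0
  then show ?case by (auto intro: bounded_linear.continuous_on[OF assms(2)])
next
  case (Suc n)
  show ?case
    by (rule Cn_on_SucI[OF assms(1) _ has_partials_linear[OF assms(2) Cn_on_has_partials]])
      (use Suc in \<open>auto intro: bounded_linear.continuous_on[OF assms(2)]\<close>)
qed

lemma Cn_on_minus:
  assumes "open U" "Cn_on n U f" "Cn_on n U g"
  shows "Cn_on n U (\<lambda>p. f p - g p)"
  using Cn_on_add[OF assms(1,2) Cn_on_linear[OF assms(1) bounded_linear_minus[OF bounded_linear_ident] assms(3)]]
  by simp

lemma Cn_on_fst:
  assumes "open U" "Cn_on n U f"
  shows "Cn_on n U (\<lambda>p. fst p *\<^sub>R f p)"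
  using assms(2)
proof (induction n arbitrary: f)
  case 0
  then show ?case by (auto intro!: continuous_intros)
next
  case (Suc n)
  have f: "continuous_on U f" "Cn_on n U f" "Cn_on n U (partial_x f)" "Cn_on n U (partial_y f)"
    using Suc.prems Cn_on_SucD by auto
  show ?case
  proof (rule Cn_on_SucI[OF assms(1)])
    show "continuous_on U (\<lambda>p. fst p *\<^sub>R f p)"
      using f(1) by (intro continuous_intros)
    show "has_partials (\<lambda>p. fst p *\<^sub>R f p) (f p + fst p *\<^sub>R partial_x f p) (fst p *\<^sub>R partial_y f p) p"
      if "p \<in> U" for p
      by (rule has_partials_fst[OF Cn_on_has_partials[OF Suc.prems that]])
    show "Cn_on n U (\<lambda>p. f p + fst p *\<^sub>R partial_x f p)"
      "Cn_on n U (\<lambda>p. fst p *\<^sub>R partial_y f p)"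
      using f by (auto intro: Suc.IH Cn_on_add[OF assms(1)])
  qed
qed

lemma Cn_on_snd:
  assumes "open U" "Cn_on n U f"
  shows "Cn_on n U (\<lambda>p. snd p *\<^sub>R f p)"
  using assms(2)
proof (induction n arbitrary: f)
  case 0
  then show ?case by (auto intro!: continuous_intros)
next
  case (Suc n)
  have f: "continuous_on U f" "Cn_on n U f" "Cn_on n U (partial_x f)" "Cn_on n U (partial_y f)"
    using Suc.prems Cn_on_SucD by auto
  show ?case
  proof (rule Cn_on_SucI[OF assms(1)])
    show "continuous_on U (\<lambda>p. snd p *\<^sub>R f p)"
      using f(1) by (intro continuous_intros)
    show "has_partials (\<lambda>p. snd p *\<^sub>R f p) (snd p *\<^sub>R partial_x f p) (f p + snd p *\<^sub>R partial_y f p) p"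
      if "p \<in> U" for p
      by (rule has_partials_snd[OF Cn_on_has_partials[OF Suc.prems that]])
    show "Cn_on n U (\<lambda>p. snd p *\<^sub>R partial_x f p)"
      "Cn_on n U (\<lambda>p. f p + snd p *\<^sub>R partial_y f p)"
      using f by (auto intro: Suc.IH Cn_on_add[OF assms(1)])
  qed
qed


section \<open>Slice coordinates\<close>

text \<open>
  \<open>slice_point I\<close> embeds the real plane as \<^term>\<open>slice_plane I\<close>; the restriction of \<open>f\<close> to that slice
  is \<open>\<lambda>p. f (slice_point I p)\<close>, to which the Cauchy-Riemann operator applies.
\<close>

definition slice_point :: "quat \<Rightarrow> real \<times> real \<Rightarrow> quat" where
  "slice_point I p = of_real (fst p) + I * of_real (snd p)"

text \<open>
  Taking norms in \<open>I * I = - 1\<close> gives \<open>norm I = 1\<close>; comparing this with the real part of the same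
  equation forces \<open>qRe I = 0\<close>. Conversely, the vector part of \<open>I * I\<close> is \<open>2 (qRe I)\<close> times that
  of \<open>I\<close>, and the real part of \<open>I * I\<close> is \<open>- (norm I)\<^sup>2\<close> once \<open>qRe I = 0\<close>.
\<close>

lemma im_sphere_iff: "I \<in> im_sphere \<longleftrightarrow> qRe I = 0 \<and> norm I = 1"
proof -
  have n: "norm I = 1 \<longleftrightarrow> qRe I * qRe I + qIm1 I * qIm1 I + qIm2 I * qIm2 I + qIm3 I * qIm3 I = 1"
    unfolding norm_quat_def inner_quat_def by simp
  show ?thesis
  proof
    assume "I \<in> im_sphere"
    then have sq: "I * I = - 1" by (simp add: im_sphere_def power2_eq_square)
    then have "norm I * norm I = 1"
      by (metis norm_minus_cancel norm_mult norm_one)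
    then have N: "norm I = 1"
      using norm_ge_zero[of I] by (simp add: square_eq_1_iff)
    have "qRe I * qRe I - qIm1 I * qIm1 I - qIm2 I * qIm2 I - qIm3 I * qIm3 I = - 1"
      using arg_cong[OF sq, of qRe] by simp
    with N n have "qRe I * qRe I = 0" by linarith
    with N show "qRe I = 0 \<and> norm I = 1" by simp
  next
    assume "qRe I = 0 \<and> norm I = 1"
    with n show "I \<in> im_sphere"
      by (simp add: im_sphere_def power2_eq_square quat_eq_iff)
  qed
qed

lemma im_sphere_square: "I \<in> im_sphere \<Longrightarrow> I * I = - 1"
  by (simp add: im_sphere_def power2_eq_square)

lemma im_sphere_mult_left: "I \<in> im_sphere \<Longrightarrow> I * (I * q) = - q"
  by (simp add: mult.assoc[symmetric] im_sphere_square)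

lemma uminus_im_sphere: "I \<in> im_sphere \<Longrightarrow> - I \<in> im_sphere"
  by (simp add: im_sphere_def)

lemma of_real_quat [simp]:
  "qRe (of_real r) = r" "qIm1 (of_real r) = 0" "qIm2 (of_real r) = 0" "qIm3 (of_real r) = 0"
  by (simp_all add: of_real_def)

lemma qcnj_slice_point:
  assumes "I \<in> im_sphere"
  shows "qcnj (slice_point I p) = of_real (fst p) - I * of_real (snd p)"
  using assms unfolding im_sphere_iff slice_point_def by (simp add: quat_eq_iff)

lemma im_sphere_nonempty: "Quat 0 1 0 0 \<in> im_sphere"
  by (simp add: im_sphere_def power2_eq_square quat_eq_iff)

lemma slice_point_mem:
  assumes "I \<in> im_sphere" "p \<in> slice_base \<Omega>"
  shows "slice_point I p \<in> \<Omega>"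
  using assms by (auto simp: slice_base_def slice_point_def)

text \<open>
  Axial symmetry reduces membership in the base, a condition on all \<open>I\<close>, to a single \<open>I\<close>. This is
  why the base is open and why every point of \<open>\<Omega>\<close> lies over it.
\<close>

lemma slice_base_iff:
  assumes "axially_symmetric \<Omega>" "I \<in> im_sphere"
  shows "p \<in> slice_base \<Omega> \<longleftrightarrow> slice_point I p \<in> \<Omega>"
  using assms unfolding axially_symmetric_def
  by (cases p) (auto simp: slice_base_def slice_point_def)

lemma slice_base_uminus: "(x, y) \<in> slice_base \<Omega> \<Longrightarrow> (x, - y) \<in> slice_base \<Omega>"
  unfolding slice_base_def using uminus_im_sphere by fastforce

lemma open_slice_base:
  assumes "axially_symmetric \<Omega>" "open \<Omega>"
  shows "open (slice_base \<Omega>)"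
proof -
  have "slice_base \<Omega> = slice_point (Quat 0 1 0 0) -` \<Omega>"
    using slice_base_iff[OF assms(1) im_sphere_nonempty] by auto
  also have "open \<dots>"
    by (rule open_vimage[OF assms(2)]) (auto simp: slice_point_def intro!: continuous_intros)
  finally show ?thesis .
qed

definition qIm :: "quat \<Rightarrow> quat" where
  "qIm q = q - of_real (qRe q)"

lemma quat_slice_point:
  obtains I p where "I \<in> im_sphere" "q = slice_point I p"
proof (cases "qIm q = 0")
  case True
  then have "q = slice_point (Quat 0 1 0 0) (qRe q, 0)"
    by (simp add: slice_point_def qIm_def)
  with im_sphere_nonempty show ?thesis using that by blast
next
  case False
  have "q = slice_point (sgn (qIm q)) (qRe q, norm (qIm q))"
    using False by (simp add: slice_point_def sgn_div_norm qIm_def of_real_def)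
  moreover have "sgn (qIm q) \<in> im_sphere"
    using False by (simp add: im_sphere_iff norm_sgn) (simp add: sgn_div_norm qIm_def)
  ultimately show ?thesis using that by blast
qed


section \<open>Slice functions of class \<open>C\<^sup>n\<close>\<close>

definition slice_Cn :: "nat \<Rightarrow> quat set \<Rightarrow> (quat \<Rightarrow> quat) \<Rightarrow> bool" where
  "slice_Cn n \<Omega> f \<longleftrightarrow> (\<exists>\<alpha> \<beta>. slice_decomposition \<Omega> f \<alpha> \<beta> \<and>
     Cn_on n (slice_base \<Omega>) \<alpha> \<and> Cn_on n (slice_base \<Omega>) \<beta>)"

lemma slice_decomposition_slice_point:
  assumes "slice_decomposition \<Omega> f \<alpha> \<beta>" "I \<in> im_sphere" "p \<in> slice_base \<Omega>"
  shows "f (slice_point I p) = \<alpha> p + I * \<beta> p"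
  using assms slice_point_mem[OF assms(2,3)]
  by (cases p) (auto simp: slice_decomposition_def slice_point_def)

lemma slice_decompositionI:
  assumes "axially_symmetric \<Omega>"
    and "\<And>I p. I \<in> im_sphere \<Longrightarrow> p \<in> slice_base \<Omega> \<Longrightarrow> f (slice_point I p) = \<alpha> p + I * \<beta> p"
    and "\<And>x y. (x, y) \<in> slice_base \<Omega> \<Longrightarrow> \<alpha> (x, - y) = \<alpha> (x, y)"
    and "\<And>x y. (x, y) \<in> slice_base \<Omega> \<Longrightarrow> \<beta> (x, - y) = - \<beta> (x, y)"
  shows "slice_decomposition \<Omega> f \<alpha> \<beta>"
  using assms(2-4) slice_base_iff[OF assms(1)]
  by (fastforce simp: slice_decomposition_def slice_point_def)

lemma slice_decomposition_even:
  "slice_decomposition \<Omega> f \<alpha> \<beta> \<Longrightarrow> (x, y) \<in> slice_base \<Omega> \<Longrightarrow> \<alpha> (x, - y) = \<alpha> (x, y)"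
  by (auto simp: slice_decomposition_def)

lemma slice_decomposition_odd:
  "slice_decomposition \<Omega> f \<alpha> \<beta> \<Longrightarrow> (x, y) \<in> slice_base \<Omega> \<Longrightarrow> \<beta> (x, - y) = - \<beta> (x, y)"
  by (auto simp: slice_decomposition_def)

lemma slice_Cn_restrict:
  assumes "open (slice_base \<Omega>)" "slice_Cn n \<Omega> f" "I \<in> im_sphere"
  shows "Cn_on n (slice_base \<Omega>) (\<lambda>p. f (slice_point I p))"
proof -
  obtain \<alpha> \<beta> where ab: "slice_decomposition \<Omega> f \<alpha> \<beta>"
    "Cn_on n (slice_base \<Omega>) \<alpha>" "Cn_on n (slice_base \<Omega>) \<beta>"
    using assms(2) unfolding slice_Cn_def by blast
  have "Cn_on n (slice_base \<Omega>) (\<lambda>p. \<alpha> p + I * \<beta> p)"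
    by (rule Cn_on_add[OF assms(1) ab(2) Cn_on_linear[OF assms(1) bounded_linear_mult_right ab(3)]])
  then show ?thesis
    by (rule Cn_on_cong[OF assms(1)])
      (simp add: slice_decomposition_slice_point[OF ab(1) assms(3)])
qed

text \<open>
  A quaternion determines its coordinates \<open>(x, y)\<close> and \<open>I\<close> only up to the sign change
  \<open>(y, I) \<mapsto> (- y, - I)\<close>, and not \<open>I\<close> at all when \<open>y = 0\<close>. The parities make \<open>\<alpha> + I \<beta>\<close>
  invariant under the sign change, and oddness gives \<open>\<beta> (x, 0) = 0\<close>.
\<close>

lemma slice_function_exists:
  assumes "axially_symmetric \<Omega>"
    and even: "\<And>x y. (x, y) \<in> slice_base \<Omega> \<Longrightarrow> \<alpha> (x, - y) = \<alpha> (x, y)"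
    and odd: "\<And>x y. (x, y) \<in> slice_base \<Omega> \<Longrightarrow> \<beta> (x, - y) = - \<beta> (x, y)"
  obtains f where "slice_decomposition \<Omega> f \<alpha> \<beta>"
proof -
  \<comment> \<open>The choice \<open>y \<ge> 0\<close>; on the real axis \<open>sgn\<close> returns \<open>0\<close>, harmless as \<open>\<beta>\<close> vanishes there.\<close>
  define f where "f q = \<alpha> (qRe q, norm (qIm q)) + sgn (qIm q) * \<beta> (qRe q, norm (qIm q))" for q
  have "f (slice_point I p) = \<alpha> p + I * \<beta> p" if I: "I \<in> im_sphere" and p: "p \<in> slice_base \<Omega>" for I p
  proof -
    obtain x y where xy: "p = (x, y)" by (cases p)
    have R: "qRe (slice_point I p) = x" "qIm (slice_point I p) = y *\<^sub>R I"
      using I by (auto simp: im_sphere_iff slice_point_def qIm_def xy quat_eq_iff)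
    have N: "norm (y *\<^sub>R I) = \<bar>y\<bar>" "sgn (y *\<^sub>R I) = sgn y *\<^sub>R I"
      using I by (auto simp: im_sphere_iff sgn_div_norm)
    have f: "f (slice_point I p) = \<alpha> (x, \<bar>y\<bar>) + (sgn y *\<^sub>R I) * \<beta> (x, \<bar>y\<bar>)"
      unfolding f_def R N ..
    consider "y > 0" | "y = 0" | "y < 0" by linarith
    then show ?thesis
    proof cases
      case 2
      then have "\<beta> (x, 0) = - \<beta> (x, 0)" using odd[of x 0] p xy by simp
      then have "\<beta> (x, 0) = 0" by (simp add: quat_eq_iff)
      with 2 f xy show ?thesis by simp
    next
      case 3
      then show ?thesis using f xy even[of x y] odd[of x y] p by simp
    qed (use f xy in simp)
  qed
  then show thesis using that slice_decompositionI[OF assms(1) _ even odd] by blast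
qed

lemma cauchy_riemann_op_cong:
  assumes "open U" "p \<in> U" "\<And>p. p \<in> U \<Longrightarrow> f p = g p"
  shows "cauchy_riemann_op I f p = cauchy_riemann_op I g p"
  using partial_x_cong[OF assms] partial_y_cong[OF assms] by (simp add: cauchy_riemann_op_def)

lemma cauchy_riemann_op_funpow_cong:
  assumes "open U" "p \<in> U" "\<And>p. p \<in> U \<Longrightarrow> f p = g p"
  shows "(cauchy_riemann_op I ^^ n) f p = (cauchy_riemann_op I ^^ n) g p"
  using assms(2,3)
proof (induction n arbitrary: p)
  case (Suc n)
  show ?case
    unfolding funpow.simps comp_apply
    by (rule cauchy_riemann_op_cong[OF assms(1) Suc.prems(1) Suc.IH]) (use Suc.prems in auto)
qed simp

text \<open>
  Since \<open>f\<close> and \<open>\<alpha> + I \<beta>\<close> agree on the open base, the differential equation can be read off from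
  \<open>f\<close>. It is thus independent of the choice of \<open>\<alpha>\<close>, \<open>\<beta>\<close> and can be manipulated on the level of
  quaternionic functions.
\<close>

lemma slice_polyanalytic_iff:
  assumes "open (slice_base \<Omega>)"
  shows "slice_polyanalytic N \<Omega> f \<longleftrightarrow> slice_Cn N \<Omega> f \<and>
    (\<forall>I\<in>im_sphere. \<forall>p\<in>slice_base \<Omega>. (cauchy_riemann_op I ^^ N) (\<lambda>p. f (slice_point I p)) p = 0)"
proof -
  have "(cauchy_riemann_op I ^^ N) (\<lambda>p. \<alpha> p + I * \<beta> p) p =
      (cauchy_riemann_op I ^^ N) (\<lambda>p. f (slice_point I p)) p"
    if "slice_decomposition \<Omega> f \<alpha> \<beta>" "I \<in> im_sphere" "p \<in> slice_base \<Omega>" for \<alpha> \<beta> I p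
    by (rule cauchy_riemann_op_funpow_cong[OF assms that(3)])
      (simp add: slice_decomposition_slice_point[OF that(1,2)])
  then show ?thesis
    unfolding slice_polyanalytic_def slice_Cn_def scaleR_eq_0_iff by fastforce
qed


section \<open>The Cauchy-Riemann derivative of a slice function\<close>

text \<open>
  This says that \<open>f\<close> is a \<open>C\<^sup>1\<close> slice function with \<open>D f = h\<close> on \<open>\<Omega>\<close>. One function \<open>h\<close> has to serve
  all the operators \<open>D\<close>, one for each \<open>I\<close>, at once. The normalising factor \<open>1/2\<close> is left out.
\<close>

definition has_slice_dbar :: "quat set \<Rightarrow> (quat \<Rightarrow> quat) \<Rightarrow> (quat \<Rightarrow> quat) \<Rightarrow> bool" where
  "has_slice_dbar \<Omega> f h \<longleftrightarrow> slice_Cn 1 \<Omega> f \<and>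
     (\<forall>I\<in>im_sphere. \<forall>p\<in>slice_base \<Omega>.
        cauchy_riemann_op I (\<lambda>p. f (slice_point I p)) p = h (slice_point I p))"

lemma slice_regular_iff:
  assumes "open (slice_base \<Omega>)"
  shows "slice_regular \<Omega> f \<longleftrightarrow> has_slice_dbar \<Omega> f (\<lambda>_. 0)"
  unfolding slice_regular_def slice_polyanalytic_iff[OF assms] has_slice_dbar_def by simp

lemma has_slice_dbar_cong:
  assumes "has_slice_dbar \<Omega> f h" "\<And>q. q \<in> \<Omega> \<Longrightarrow> h q = h' q"
  shows "has_slice_dbar \<Omega> f h'"
  using assms slice_point_mem unfolding has_slice_dbar_def by metis

text \<open>
  With \<open>c = 1\<close> for even and \<open>c = - 1\<close> for odd functions: differentiating the parity relation in \<open>x\<close>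
  keeps the parity, while in \<open>y\<close> the chain rule contributes a further sign.
\<close>

lemma partials_reflected:
  assumes "open (slice_base \<Omega>)" "(x, y) \<in> slice_base \<Omega>"
    and "has_partials g a b (x, y)"
    and "\<And>x y. (x, y) \<in> slice_base \<Omega> \<Longrightarrow> g (x, - y) = c *\<^sub>R g (x, y)"
  shows "partial_x g (x, - y) = c *\<^sub>R partial_x g (x, y)"
    and "partial_y g (x, - y) = - c *\<^sub>R partial_y g (x, y)"
proof -
  have d: "((\<lambda>t. g (t, y)) has_vector_derivative a) (at x)"
    "((\<lambda>t. g (x, t)) has_vector_derivative b) (at y)"
    using assms(3) by (auto simp: has_partials_def)
  have x: "((\<lambda>t. g (t, - y)) has_vector_derivative c *\<^sub>R a) (at x)"
    by (rule has_vector_derivative_transform_within_open[OF _ open_horizontal_line[OF assms(1), of y]])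
      (use assms(2,4) d(1) in \<open>auto intro!: derivative_eq_intros\<close>)
  have "((\<lambda>t. g (x, - t)) has_vector_derivative - b) (at (- y))"
  proof -
    have "(uminus has_vector_derivative (- 1 :: real)) (at (- y))"
      by (auto intro!: derivative_eq_intros)
    from vector_diff_chain_at[OF this, of "\<lambda>t. g (x, t)" b] d(2) show ?thesis
      by (simp add: o_def)
  qed
  then have v: "((\<lambda>t. c *\<^sub>R g (x, - t)) has_vector_derivative c *\<^sub>R (- b)) (at (- y))"
    by (auto intro!: derivative_eq_intros)
  have "c *\<^sub>R g (x, - t) = g (x, t)" if "(x, t) \<in> slice_base \<Omega>" for t
    using assms(4)[OF slice_base_uminus[OF that]] by simp
  then have y: "((\<lambda>t. g (x, t)) has_vector_derivative c *\<^sub>R (- b)) (at (- y))"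
    by (intro has_vector_derivative_transform_within_open[OF v open_vertical_line[OF assms(1), of x]])
      (use assms(2) slice_base_uminus in auto)
  have "has_partials g (c *\<^sub>R a) (c *\<^sub>R (- b)) (x, - y)"
    using x y by (simp add: has_partials_def)
  from has_partials_imp[OF this] has_partials_imp[OF assms(3)]
  show "partial_x g (x, - y) = c *\<^sub>R partial_x g (x, y)"
    and "partial_y g (x, - y) = - c *\<^sub>R partial_y g (x, y)" by simp_all
qed

text \<open>
  The derivative of \<open>\<alpha> + I \<beta>\<close> is \<open>(\<alpha>\<^sub>x - \<beta>\<^sub>y) + I (\<beta>\<^sub>x + \<alpha>\<^sub>y)\<close>; the two brackets do not involve \<open>I\<close>, and
  they are even and odd in \<open>y\<close>, respectively. Only one order of differentiability is lost.
\<close>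

lemma slice_dbar_exists:
  assumes "axially_symmetric \<Omega>" "open (slice_base \<Omega>)" "slice_Cn (Suc n) \<Omega> f"
  obtains h where "slice_Cn n \<Omega> h" "has_slice_dbar \<Omega> f h"
proof -
  let ?U = "slice_base \<Omega>"
  obtain \<alpha> \<beta> where ab: "slice_decomposition \<Omega> f \<alpha> \<beta>"
    "Cn_on (Suc n) ?U \<alpha>" "Cn_on (Suc n) ?U \<beta>"
    using assms(3) unfolding slice_Cn_def by blast
  define a where "a p = partial_x \<alpha> p - partial_y \<beta> p" for p
  define b where "b p = partial_x \<beta> p + partial_y \<alpha> p" for p
  have C: "Cn_on n ?U a" "Cn_on n ?U b"
    using ab(2,3) unfolding a_def b_def
    by (auto intro!: Cn_on_add Cn_on_minus assms(2))
  have S: "partial_x \<alpha> (x, - y) = partial_x \<alpha> (x, y)" "partial_y \<alpha> (x, - y) = - partial_y \<alpha> (x, y)"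
    "partial_x \<beta> (x, - y) = - partial_x \<beta> (x, y)" "partial_y \<beta> (x, - y) = partial_y \<beta> (x, y)"
    if "(x, y) \<in> ?U" for x y
    using partials_reflected[OF assms(2) that Cn_on_has_partials[OF ab(2) that], of 1]
      partials_reflected[OF assms(2) that Cn_on_has_partials[OF ab(3) that], of "- 1"]
      slice_decomposition_even[OF ab(1)] slice_decomposition_odd[OF ab(1)] by auto
  obtain h where h: "slice_decomposition \<Omega> h a b"
    by (rule slice_function_exists[OF assms(1), of a b]) (auto simp: a_def b_def S)
  have "cauchy_riemann_op I (\<lambda>p. f (slice_point I p)) p = h (slice_point I p)"
    if I: "I \<in> im_sphere" and p: "p \<in> ?U" for I p
  proof -
    have "cauchy_riemann_op I (\<lambda>p. f (slice_point I p)) p = cauchy_riemann_op I (\<lambda>p. \<alpha> p + I * \<beta> p) p"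
      by (rule cauchy_riemann_op_cong[OF assms(2) p slice_decomposition_slice_point[OF ab(1) I]])
    also have "\<dots> = (partial_x \<alpha> p + I * partial_x \<beta> p) + I * (partial_y \<alpha> p + I * partial_y \<beta> p)"
      using has_partials_imp[OF has_partials_add[OF Cn_on_has_partials[OF ab(2) p]
          has_partials_linear[OF bounded_linear_mult_right Cn_on_has_partials[OF ab(3) p]]], of I]
      by (simp add: cauchy_riemann_op_def)
    also have "\<dots> = a p + I * b p"
      using im_sphere_mult_left[OF I] by (simp add: a_def b_def algebra_simps)
    finally show ?thesis using slice_decomposition_slice_point[OF h I p] by simp
  qed
  moreover have "slice_Cn 1 \<Omega> f"
  proof -
    have "Cn_on 1 ?U g" if "Cn_on (Suc n) ?U g" for g :: "real \<times> real \<Rightarrow> quat"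
      using that continuous_on_Cn_on by auto
    with ab show ?thesis unfolding slice_Cn_def by blast
  qed
  ultimately have "has_slice_dbar \<Omega> f h" unfolding has_slice_dbar_def by blast
  moreover have "slice_Cn n \<Omega> h" using h C unfolding slice_Cn_def by blast
  ultimately show thesis using that by blast
qed

lemma has_slice_dbar_partials:
  assumes "open (slice_base \<Omega>)" "has_slice_dbar \<Omega> f h" "I \<in> im_sphere" "p \<in> slice_base \<Omega>"
  obtains a b where "has_partials (\<lambda>p. f (slice_point I p)) a b p" "h (slice_point I p) = a + I * b"
proof -
  let ?F = "\<lambda>p. f (slice_point I p)"
  have "Cn_on (Suc 0) (slice_base \<Omega>) ?F"
    using slice_Cn_restrict[OF assms(1) _ assms(3), of 1] assms(2) by (simp add: has_slice_dbar_def)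
  then have "has_partials ?F (partial_x ?F p) (partial_y ?F p) p"
    using Cn_on_has_partials assms(4) by blast
  moreover have "h (slice_point I p) = partial_x ?F p + I * partial_y ?F p"
    using assms(2-4) by (simp add: has_slice_dbar_def cauchy_riemann_op_def)
  ultimately show thesis by (rule that)
qed

lemma has_slice_dbarI:
  assumes "slice_Cn 1 \<Omega> f"
    and "\<And>I p. I \<in> im_sphere \<Longrightarrow> p \<in> slice_base \<Omega> \<Longrightarrow>
      \<exists>a b. has_partials (\<lambda>p. f (slice_point I p)) a b p \<and> h (slice_point I p) = a + I * b"
  shows "has_slice_dbar \<Omega> f h"
  using assms has_partials_imp unfolding has_slice_dbar_def cauchy_riemann_op_def by metis

lemma slice_Cn_add:
  assumes "axially_symmetric \<Omega>" "open (slice_base \<Omega>)" "slice_Cn n \<Omega> f" "slice_Cn n \<Omega> g"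
  shows "slice_Cn n \<Omega> (\<lambda>q. f q + g q)"
proof -
  obtain a b where f: "slice_decomposition \<Omega> f a b" "Cn_on n (slice_base \<Omega>) a" "Cn_on n (slice_base \<Omega>) b"
    using assms(3) unfolding slice_Cn_def by blast
  obtain c d where g: "slice_decomposition \<Omega> g c d" "Cn_on n (slice_base \<Omega>) c" "Cn_on n (slice_base \<Omega>) d"
    using assms(4) unfolding slice_Cn_def by blast
  have "slice_decomposition \<Omega> (\<lambda>q. f q + g q) (\<lambda>p. a p + c p) (\<lambda>p. b p + d p)"
    by (rule slice_decompositionI[OF assms(1)])
      (simp_all add: slice_decomposition_slice_point[OF f(1)] slice_decomposition_slice_point[OF g(1)]
        slice_decomposition_even[OF f(1)] slice_decomposition_even[OF g(1)]
        slice_decomposition_odd[OF f(1)] slice_decomposition_odd[OF g(1)] algebra_simps)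
  with Cn_on_add[OF assms(2) f(2) g(2)] Cn_on_add[OF assms(2) f(3) g(3)]
  show ?thesis unfolding slice_Cn_def by blast
qed

lemma slice_Cn_scaleR:
  assumes "axially_symmetric \<Omega>" "open (slice_base \<Omega>)" "slice_Cn n \<Omega> f"
  shows "slice_Cn n \<Omega> (\<lambda>q. r *\<^sub>R f q)"
proof -
  obtain a b where f: "slice_decomposition \<Omega> f a b" "Cn_on n (slice_base \<Omega>) a" "Cn_on n (slice_base \<Omega>) b"
    using assms(3) unfolding slice_Cn_def by blast
  have "slice_decomposition \<Omega> (\<lambda>q. r *\<^sub>R f q) (\<lambda>p. r *\<^sub>R a p) (\<lambda>p. r *\<^sub>R b p)"
    by (rule slice_decompositionI[OF assms(1)])
      (simp_all add: slice_decomposition_slice_point[OF f(1)]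
        slice_decomposition_even[OF f(1)] slice_decomposition_odd[OF f(1)] algebra_simps)
  with Cn_on_linear[OF assms(2) bounded_linear_scaleR_right f(2)]
    Cn_on_linear[OF assms(2) bounded_linear_scaleR_right f(3)]
  show ?thesis unfolding slice_Cn_def by blast
qed

text \<open>
  The components come from \<open>(x - I y) (\<alpha> + I \<beta>) = (x \<alpha> + y \<beta>) + I (x \<beta> - y \<alpha>)\<close>, which uses
  \<open>I\<^sup>2 = - 1\<close>. That \<open>qcnj q\<close> stands on the left matters: \<open>x - I y\<close> commutes with \<open>I\<close>, but not
  with \<open>\<alpha>\<close> and \<open>\<beta>\<close>.
\<close>

lemma slice_Cn_qcnj_mult:
  assumes "axially_symmetric \<Omega>" "open (slice_base \<Omega>)" "slice_Cn n \<Omega> f"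
  shows "slice_Cn n \<Omega> (\<lambda>q. qcnj q * f q)"
proof -
  obtain a b where f: "slice_decomposition \<Omega> f a b" "Cn_on n (slice_base \<Omega>) a" "Cn_on n (slice_base \<Omega>) b"
    using assms(3) unfolding slice_Cn_def by blast
  have "slice_decomposition \<Omega> (\<lambda>q. qcnj q * f q)
      (\<lambda>p. fst p *\<^sub>R a p + snd p *\<^sub>R b p) (\<lambda>p. fst p *\<^sub>R b p - snd p *\<^sub>R a p)"
    by (rule slice_decompositionI[OF assms(1)])
      (simp_all add: slice_decomposition_slice_point[OF f(1)] qcnj_slice_point of_real_def
        im_sphere_mult_left slice_decomposition_even[OF f(1)] slice_decomposition_odd[OF f(1)]
        algebra_simps)
  moreover have "Cn_on n (slice_base \<Omega>) (\<lambda>p. fst p *\<^sub>R a p + snd p *\<^sub>R b p)"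
    "Cn_on n (slice_base \<Omega>) (\<lambda>p. fst p *\<^sub>R b p - snd p *\<^sub>R a p)"
    by (simp_all add: Cn_on_add Cn_on_minus Cn_on_fst Cn_on_snd assms(2) f)
  ultimately show ?thesis unfolding slice_Cn_def by blast
qed

lemma has_slice_dbar_add:
  assumes "axially_symmetric \<Omega>" "open (slice_base \<Omega>)" "has_slice_dbar \<Omega> f h" "has_slice_dbar \<Omega> g k"
  shows "has_slice_dbar \<Omega> (\<lambda>q. f q + g q) (\<lambda>q. h q + k q)"
proof (rule has_slice_dbarI)
  show "slice_Cn 1 \<Omega> (\<lambda>q. f q + g q)"
    using slice_Cn_add[OF assms(1,2)] assms(3,4) by (simp add: has_slice_dbar_def)
next
  fix I p assume Ip: "I \<in> im_sphere" "p \<in> slice_base \<Omega>"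
  obtain a b where f: "has_partials (\<lambda>p. f (slice_point I p)) a b p" "h (slice_point I p) = a + I * b"
    using has_slice_dbar_partials[OF assms(2,3) Ip] .
  obtain c d where g: "has_partials (\<lambda>p. g (slice_point I p)) c d p" "k (slice_point I p) = c + I * d"
    using has_slice_dbar_partials[OF assms(2,4) Ip] .
  show "\<exists>a b. has_partials (\<lambda>p. f (slice_point I p) + g (slice_point I p)) a b p \<and>
      h (slice_point I p) + k (slice_point I p) = a + I * b"
    using has_partials_add[OF f(1) g(1)] f(2) g(2)
    by (intro exI[of _ "a + c"] exI[of _ "b + d"]) (simp add: algebra_simps)
qed

lemma has_slice_dbar_scaleR:
  assumes "axially_symmetric \<Omega>" "open (slice_base \<Omega>)" "has_slice_dbar \<Omega> f h"
  shows "has_slice_dbar \<Omega> (\<lambda>q. r *\<^sub>R f q) (\<lambda>q. r *\<^sub>R h q)"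
proof (rule has_slice_dbarI)
  show "slice_Cn 1 \<Omega> (\<lambda>q. r *\<^sub>R f q)"
    using slice_Cn_scaleR[OF assms(1,2)] assms(3) by (simp add: has_slice_dbar_def)
next
  fix I p assume Ip: "I \<in> im_sphere" "p \<in> slice_base \<Omega>"
  obtain a b where f: "has_partials (\<lambda>p. f (slice_point I p)) a b p" "h (slice_point I p) = a + I * b"
    using has_slice_dbar_partials[OF assms(2,3) Ip] .
  show "\<exists>a b. has_partials (\<lambda>p. r *\<^sub>R f (slice_point I p)) a b p \<and>
      r *\<^sub>R h (slice_point I p) = a + I * b"
    using has_partials_linear[OF bounded_linear_scaleR_right f(1)] f(2)
    by (intro exI[of _ "r *\<^sub>R a"] exI[of _ "r *\<^sub>R b"]) (simp add: algebra_simps)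
qed

lemma has_slice_dbar_sum:
  assumes "axially_symmetric \<Omega>" "open (slice_base \<Omega>)" "has_slice_dbar \<Omega> f h"
    and "finite K" "\<And>k. k \<in> K \<Longrightarrow> has_slice_dbar \<Omega> (g k) (d k)"
  shows "has_slice_dbar \<Omega> (\<lambda>q. f q + (\<Sum>k\<in>K. g k q)) (\<lambda>q. h q + (\<Sum>k\<in>K. d k q))"
  using assms(4,5)
proof (induction K rule: finite_induct)
  case (insert k K)
  have "has_slice_dbar \<Omega> (\<lambda>q. g k q + (f q + (\<Sum>k\<in>K. g k q))) (\<lambda>q. d k q + (h q + (\<Sum>k\<in>K. d k q)))"
    by (rule has_slice_dbar_add[OF assms(1,2)]) (use insert in auto)
  then show ?case using insert by (simp add: algebra_simps)
qed (use assms(3) in simp)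

text \<open>
  This is the Leibniz rule with \<open>D (x - I y) = 1 - I * I = 2\<close>; the operator \<open>D\<close> passes through
  the left factor \<open>x - I y\<close> because that factor commutes with \<open>I\<close>.
\<close>

lemma has_slice_dbar_qcnj_mult:
  assumes "axially_symmetric \<Omega>" "open (slice_base \<Omega>)" "has_slice_dbar \<Omega> f h"
  shows "has_slice_dbar \<Omega> (\<lambda>q. qcnj q * f q) (\<lambda>q. 2 *\<^sub>R f q + qcnj q * h q)"
proof (rule has_slice_dbarI)
  show "slice_Cn 1 \<Omega> (\<lambda>q. qcnj q * f q)"
    using slice_Cn_qcnj_mult[OF assms(1,2)] assms(3) by (simp add: has_slice_dbar_def)
next
  fix I p assume Ip: "I \<in> im_sphere" "p \<in> slice_base \<Omega>"
  let ?F = "\<lambda>p. f (slice_point I p)"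
  obtain a b where f: "has_partials ?F a b p" "h (slice_point I p) = a + I * b"
    using has_slice_dbar_partials[OF assms(2,3) Ip] .
  have E: "(\<lambda>p. qcnj (slice_point I p) * ?F p) = (\<lambda>p. fst p *\<^sub>R ?F p + (- I) * (snd p *\<^sub>R ?F p))"
    using Ip(1) by (auto simp: qcnj_slice_point of_real_def algebra_simps)
  have "has_partials (\<lambda>p. qcnj (slice_point I p) * ?F p)
     (?F p + fst p *\<^sub>R a + (- I) * (snd p *\<^sub>R a)) (fst p *\<^sub>R b + (- I) * (?F p + snd p *\<^sub>R b)) p"
    unfolding E
    by (intro has_partials_add has_partials_linear[OF bounded_linear_mult_right]
        has_partials_fst has_partials_snd f)
  moreover have "2 *\<^sub>R ?F p + qcnj (slice_point I p) * h (slice_point I p) =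
     (?F p + fst p *\<^sub>R a + (- I) * (snd p *\<^sub>R a)) + I * (fst p *\<^sub>R b + (- I) * (?F p + snd p *\<^sub>R b))"
    using Ip(1) by (simp add: f qcnj_slice_point of_real_def algebra_simps im_sphere_mult_left scaleR_2)
  ultimately show "\<exists>a b. has_partials (\<lambda>p. qcnj (slice_point I p) * ?F p) a b p \<and>
      2 *\<^sub>R ?F p + qcnj (slice_point I p) * h (slice_point I p) = a + I * b" by blast
qed

lemma has_slice_dbar_qcnj_power:
  assumes "axially_symmetric \<Omega>" "open (slice_base \<Omega>)" "has_slice_dbar \<Omega> g (\<lambda>_. 0)"
  shows "has_slice_dbar \<Omega> (\<lambda>q. qcnj q ^ Suc k * g q) (\<lambda>q. (2 * real (Suc k)) *\<^sub>R (qcnj q ^ k * g q))"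
proof (induction k)
  case 0
  show ?case using has_slice_dbar_qcnj_mult[OF assms] by simp
next
  case (Suc k)
  have "2 *\<^sub>R (qcnj q ^ Suc k * g q) + qcnj q * ((2 * real (Suc k)) *\<^sub>R (qcnj q ^ k * g q)) =
      (2 * real (Suc (Suc k))) *\<^sub>R (qcnj q ^ Suc k * g q)" for q
    by (simp add: mult.assoc flip: scaleR_add_left)
  with has_slice_dbar_qcnj_mult[OF assms(1,2) Suc] show ?case
    by (simp only: power_Suc[of _ "Suc k"] mult.assoc)
qed


section \<open>Expansion in powers of the conjugate variable\<close>

text \<open>
  The induction can start at order \<open>0\<close>, where polyanalytic means zero on \<open>\<Omega>\<close> and the sum is
  empty. In the step, the expansion of \<open>D f\<close> is integrated term by term.
\<close>

lemma slice_polyanalytic_decomposition: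
  assumes "axially_symmetric \<Omega>" "open \<Omega>" "slice_polyanalytic N \<Omega> f"
  shows "\<exists>g. (\<forall>k<N. slice_regular \<Omega> (g k)) \<and> (\<forall>q\<in>\<Omega>. f q = (\<Sum>k<N. qcnj q ^ k * g k q))"
proof -
  note U = open_slice_base[OF assms(1,2)]
  show ?thesis
    using assms(3)
  proof (induction N arbitrary: f)
    case 0
    have "f q = 0" if "q \<in> \<Omega>" for q
    proof -
      obtain I p where "I \<in> im_sphere" "q = slice_point I p" by (rule quat_slice_point)
      then show ?thesis
        using 0 that slice_base_iff[OF assms(1)] by (simp add: slice_polyanalytic_iff[OF U])
    qed
    then show ?case by simp
  next
    case (Suc N)
    have f: "slice_Cn (Suc N) \<Omega> f"
      "\<And>I p. I \<in> im_sphere \<Longrightarrow> p \<in> slice_base \<Omega> \<Longrightarrow>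
        (cauchy_riemann_op I ^^ N) (cauchy_riemann_op I (\<lambda>p. f (slice_point I p))) p = 0"
      using Suc.prems unfolding slice_polyanalytic_iff[OF U] by (simp_all add: funpow_swap1)
    obtain h where h: "slice_Cn N \<Omega> h" "has_slice_dbar \<Omega> f h"
      using slice_dbar_exists[OF assms(1) U f(1)] .
    have "slice_polyanalytic N \<Omega> h"
      unfolding slice_polyanalytic_iff[OF U]
    proof (intro conjI ballI h(1))
      fix I p assume Ip: "I \<in> im_sphere" "p \<in> slice_base \<Omega>"
      show "(cauchy_riemann_op I ^^ N) (\<lambda>p. h (slice_point I p)) p = 0"
      proof (subst cauchy_riemann_op_funpow_cong[OF U Ip(2)])
        show "h (slice_point I p) = cauchy_riemann_op I (\<lambda>p. f (slice_point I p)) p"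
          if "p \<in> slice_base \<Omega>" for p
          using h(2) Ip(1) that by (simp add: has_slice_dbar_def)
      qed (rule f(2)[OF Ip])
    qed
    from Suc.IH[OF this] obtain g where g: "\<And>k. k < N \<Longrightarrow> slice_regular \<Omega> (g k)"
      "\<And>q. q \<in> \<Omega> \<Longrightarrow> h q = (\<Sum>k<N. qcnj q ^ k * g k q)" by blast
    \<comment> \<open>Cancels the factor in \<open>D (qcnj q ^ (k + 1) * g) = 2 (k + 1) qcnj q ^ k * g\<close>, and subtracts.\<close>
    define c where "c k = - inverse (2 * real (Suc k))" for k
    define f0 where "f0 q = f q + (\<Sum>k<N. c k *\<^sub>R (qcnj q ^ Suc k * g k q))" for q
    have "has_slice_dbar \<Omega> f0
      (\<lambda>q. h q + (\<Sum>k<N. c k *\<^sub>R ((2 * real (Suc k)) *\<^sub>R (qcnj q ^ k * g k q))))"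
      unfolding f0_def
      by (intro has_slice_dbar_sum has_slice_dbar_scaleR has_slice_dbar_qcnj_power assms(1) U h(2))
        (use g(1) slice_regular_iff[OF U] in auto)
    moreover have "c k *\<^sub>R ((2 * real (Suc k)) *\<^sub>R v) = - v" for k and v :: quat
    proof -
      have "c k * (2 * real (Suc k)) = - 1" by (simp add: c_def field_simps)
      then show ?thesis by (metis scaleR_minus1_left scaleR_scaleR)
    qed
    ultimately have "has_slice_dbar \<Omega> f0 (\<lambda>_. 0)"
      by (elim has_slice_dbar_cong) (simp add: g(2) sum_negf)
    then have f0: "slice_regular \<Omega> f0" by (simp add: slice_regular_iff[OF U])
    define g' where "g' k = (case k of 0 \<Rightarrow> f0 | Suc k \<Rightarrow> (\<lambda>q. - c k *\<^sub>R g k q))" for k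
    have "slice_regular \<Omega> (g' k)" if "k < Suc N" for k
    proof (cases k)
      case (Suc j)
      with that g(1)[of j] has_slice_dbar_scaleR[OF assms(1) U, of "g j" "\<lambda>_. 0" "- c j"] show ?thesis
        by (simp add: g'_def slice_regular_iff[OF U])
    qed (simp add: g'_def f0)
    moreover have "f q = (\<Sum>k<Suc N. qcnj q ^ k * g' k q)" for q
      unfolding sum.lessThan_Suc_shift
      by (simp add: g'_def f0_def sum_negf del: power_Suc)
    ultimately show ?case by blast
  qed
qed

theorem proposition3p6:
  fixes N :: nat and \<Omega> :: "quat set" and f :: "quat \<Rightarrow> quat"
  assumes "N \<ge> 1"
    and "axially_symmetric \<Omega>"
    and "slice_domain \<Omega>"
    and "slice_polyanalytic N \<Omega> f"
  shows "\<exists>g :: nat \<Rightarrow> quat \<Rightarrow> quat.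
           (\<forall>k<N. slice_regular \<Omega> (g k)) \<and>
           (\<forall>q\<in>\<Omega>. f q = (\<Sum>k<N. qcnj q ^ k * g k q))"
  using slice_polyanalytic_decomposition[OF assms(2) _ assms(4)] assms(3)
  unfolding slice_domain_def by blast

end
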